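(* Let $\mathcal H$ be a real Hilbert space and let $\Phi:\mathcal H\to\mathbb R$ be a continuously differentiable convex function with $\operatorname{argmin}\Phi\neq\emptyset$. Let $t_0>0$, $\alpha>3$, and let $x:[t_0,+\infty[\to\mathcal H$ be a solution of $$\ddot x(t)+\frac{\alpha}{t}\dot x(t)+\nabla\Phi(x(t))=0 .$$ Then $x(t)$ converges weakly, as $t\to+\infty$, to a point in $\operatorname{argmin}\Phi$.
   Context: A solution on $[t_0,+\infty[$ is a twice continuously differentiable function $x:[t_0,+\infty[\to\mathcal H$ satisfying the equation for all $t\ge t_0$. $\operatorname{argmin}\Phi$ denotes the set of global minimizers of $\Phi$. *)

theory Defs
  imports "HOL-Analysis.Analysis"
begin

definition argmin :: "('a \<Rightarrow> real) \<Rightarrow> 'a set" where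
  "argmin f = {u. is_arg_min f (\<lambda>_. True) u}"

(* On a Hilbert space every Frechet derivative of a real function is represented by a
   gradient vector (Riesz), isometrically; hence "continuously differentiable, with
   gradient G" is expressed by the continuity of G. *)
definition C1_with_gradient :: "('a::real_inner \<Rightarrow> real) \<Rightarrow> ('a \<Rightarrow> 'a) \<Rightarrow> bool" where
  "C1_with_gradient f G \<longleftrightarrow> (\<forall>u. GDERIV f u :> G u) \<and> continuous_on UNIV G"

(* The derivatives are taken within the half-line, so they are one-sided at t0, and the
   values of x before t0 play no role. *)
definition avd_solution ::
    "real \<Rightarrow> ('a::real_inner \<Rightarrow> 'a) \<Rightarrow> real \<Rightarrow> (real \<Rightarrow> 'a) \<Rightarrow> bool" where
  "avd_solution \<alpha> G t0 x \<longleftrightarrow>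
     (\<exists>x' x''.
        (\<forall>t\<ge>t0. (x has_vector_derivative x' t) (at t within {t0..})) \<and>
        (\<forall>t\<ge>t0. (x' has_vector_derivative x'' t) (at t within {t0..})) \<and>
        continuous_on {t0..} x'' \<and>
        (\<forall>t\<ge>t0. x'' t + (\<alpha> / t) *\<^sub>R x' t + G (x t) = 0))"

definition weakly_tendsto ::
    "('b \<Rightarrow> 'a::real_normed_vector) \<Rightarrow> 'a \<Rightarrow> 'b filter \<Rightarrow> bool" where
  "weakly_tendsto f l F \<longleftrightarrow>
     (\<forall>\<phi> :: 'a \<Rightarrow> real. bounded_linear \<phi> \<longrightarrow> ((\<lambda>t. \<phi> (f t)) \<longlongrightarrow> \<phi> l) F)"

end

theory Submission
  imports Defs
begin

text \<open>For a minimizer \<open>z\<close>, the energies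
  \<open>t\<^sup>2 (\<Phi> (x t) - \<Phi> z) + \<parallel>(\<alpha> - 1) (x t - z) + t x' t\<parallel>\<^sup>2 / 2\<close> and
  \<open>t\<^sup>2 (\<Phi> (x t) - \<Phi> z + \<parallel>x' t\<parallel>\<^sup>2 / 2)\<close> have a nonnegative combination \<open>K\<close> with
  \<open>K' t \<le> - t \<parallel>x' t\<parallel>\<^sup>2\<close>. With \<open>h t = \<parallel>x t - z\<parallel>\<^sup>2 / 2\<close> the equation yields
  \<open>(t h' + (\<alpha> - 1) h)' \<le> t \<parallel>x'\<parallel>\<^sup>2\<close>, so \<open>t h' + (\<alpha> - 1) h + K\<close> decreases; it is bounded
  below, so \<open>t h' + (\<alpha> - 1) h\<close> converges, and then so does \<open>h\<close> by l'Hospital's rule applied to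
  \<open>t\<^sup>\<alpha>\<^sup>-\<^sup>1 h / t\<^sup>\<alpha>\<^sup>-\<^sup>1\<close>. Boundedness of the first energy gives \<open>\<Phi> (x t) \<longlongrightarrow> \<Phi> z\<close>, and Opial's lemma
  concludes.\<close>

section \<open>Intersections of nested closed convex sets in Hilbert space\<close>

text \<open>Points \<open>c n\<close> of nearly minimal norm in \<open>C n\<close> form a Cauchy
  sequence: the midpoint of \<open>c m\<close> and \<open>c n\<close> stays in the convex set
  \<open>C n\<close>, so its norm is at least \<open>d n\<close>, and the parallelogram law then
  forces the two points together. By closedness the limit lies in every \<open>C n\<close>.
  Boundedness of \<open>C 0\<close> is what keeps the minimal norms \<open>d n\<close> from escaping
  to infinity.\<close>

lemma nested_convex_inter_nonempty:
  fixes C :: "nat \<Rightarrow> 'a::{real_inner, complete_space} set"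
  assumes "decseq C"
    and closed: "\<And>n. closed (C n)"
    and convex: "\<And>n. convex (C n)"
    and ne: "\<And>n. C n \<noteq> {}"
    and bounded: "bounded (C 0)"
  shows "(\<Inter>n. C n) \<noteq> {}"
proof -
  define d where "d n = (INF y\<in>C n. norm y)" for n
  have bdd: "bdd_below (norm ` C n)" for n
    by (rule bdd_belowI2[where m=0]) simp
  have d_le: "d n \<le> norm y" if "y \<in> C n" for n y
    unfolding d_def using bdd that by (rule cINF_lower)
  have sub: "C n \<subseteq> C m" if "m \<le> n" for m n
    using assms(1) that by (auto simp: decseq_def)
  have d_mono: "d m \<le> d n" if "m \<le> n" for m n
    unfolding d_def[of n] using sub[OF that] ne d_le by (intro cINF_greatest) auto
  obtain M where M: "\<And>y. y \<in> C 0 \<Longrightarrow> norm y \<le> M"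
    using bounded by (auto simp: bounded_iff)
  have "d n \<le> M" for n
    using ne[of n] d_le[of _ n] M sub[of 0 n] by force
  then obtain l where l: "d \<longlonglongrightarrow> l" and d_le_l: "\<And>n. d n \<le> l"
    using incseq_convergent[of d M] d_mono by (auto simp: incseq_def)
  have d_nonneg: "0 \<le> d n" for n
    unfolding d_def using ne by (intro cINF_greatest) auto
  define e where "e n = 1 / real (Suc n)" for n
  have e_pos: "e n > 0" for n by (simp add: e_def)
  have "\<exists>y\<in>C n. norm y < d n + e n" for n
    using cINF_less_iff[OF ne bdd, of n "d n + e n"] e_pos unfolding d_def by simp
  then obtain c where c: "\<And>n. c n \<in> C n" and c_less: "\<And>n. norm (c n) < d n + e n"
    by metis
  \<comment> \<open>The parallelogram bound for \<open>c m - c n\<close> when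
    \<open>n \<le> m\<close>: both points have norm at most \<open>l + e n\<close>, and their
    midpoint has norm at least \<open>d n\<close>.\<close>
  define r where "r n = 4 * (l + e n)\<^sup>2 - 4 * (d n)\<^sup>2" for n
  have "e \<longlonglongrightarrow> 0"
    unfolding e_def using LIMSEQ_inverse_real_of_nat by (simp add: inverse_eq_divide)
  then have "r \<longlonglongrightarrow> 4 * (l + 0)\<^sup>2 - 4 * l\<^sup>2"
    unfolding r_def by (intro tendsto_intros l)
  then have r: "r \<longlonglongrightarrow> 0" by simp
  have dist: "(norm (c m - c n))\<^sup>2 \<le> r n" if "n \<le> m" for m n
  proof -
    have "c m \<in> C n" using c sub[OF that] by auto
    then have "(1/2) *\<^sub>R c m + (1/2) *\<^sub>R c n \<in> C n"
      using convexD[OF convex[of n] _ c[of n], of "c m" "1/2" "1/2"] by simp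
    then have "d n \<le> norm ((1/2) *\<^sub>R c m + (1/2) *\<^sub>R c n)"
      by (rule d_le)
    then have "(d n)\<^sup>2 \<le> (norm ((1/2) *\<^sub>R c m + (1/2) *\<^sub>R c n))\<^sup>2"
      using d_nonneg by (intro power_mono)
    moreover have "e m \<le> e n" unfolding e_def using that by (simp add: frac_le)
    then have "norm (c m) \<le> l + e n" "norm (c n) \<le> l + e n"
      using c_less[of m] c_less[of n] d_le_l[of m] d_le_l[of n] by linarith+
    then have "(norm (c m))\<^sup>2 \<le> (l + e n)\<^sup>2" "(norm (c n))\<^sup>2 \<le> (l + e n)\<^sup>2"
      by (intro power_mono; simp)+
    moreover have "(norm (c m - c n))\<^sup>2 = 2 * (norm (c m))\<^sup>2 + 2 * (norm (c n))\<^sup>2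
        - 4 * (norm ((1/2) *\<^sub>R c m + (1/2) *\<^sub>R c n))\<^sup>2"
      unfolding power2_norm_eq_inner
      by (simp add: inner_diff inner_add inner_commute algebra_simps)
    ultimately show ?thesis unfolding r_def by linarith
  qed
  have "Cauchy c"
  proof (rule metric_CauchyI)
    fix \<epsilon> :: real assume "\<epsilon> > 0"
    then have "\<forall>\<^sub>F n in sequentially. r n < (\<epsilon>/2)\<^sup>2"
      using r by (intro order_tendstoD) auto
    then obtain N where "r N < (\<epsilon>/2)\<^sup>2" by (auto simp: eventually_sequentially)
    then have "(norm (c m - c N))\<^sup>2 < (\<epsilon>/2)\<^sup>2" if "m \<ge> N" for m
      using dist[OF that] by linarith
    then have "dist (c m) (c N) < \<epsilon>/2" if "m \<ge> N" for m
      unfolding dist_norm using that \<open>\<epsilon> > 0\<close> power2_less_imp_less[of _ "\<epsilon>/2"] by auto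
    then have "dist (c m) (c n) < \<epsilon>" if "m \<ge> N" "n \<ge> N" for m n
      using that dist_triangle_half_l[of "c m" "c N" \<epsilon> "c n"] by simp
    then show "\<exists>N. \<forall>m\<ge>N. \<forall>n\<ge>N. dist (c m) (c n) < \<epsilon>" by blast
  qed
  then obtain p where p: "c \<longlonglongrightarrow> p"
    using Cauchy_convergent[of c] by (auto simp: convergent_def)
  have "p \<in> C n" for n
  proof (rule Lim_in_closed_set[OF closed _ _ p])
    show "\<forall>\<^sub>F m in sequentially. c m \<in> C n"
      using eventually_ge_at_top[of n] by eventually_elim (use c sub in blast)
  qed simp
  then show ?thesis by auto
qed

text \<open>The point \<open>p\<close> plays the role of a weak cluster point of \<open>x\<close>
  along the times satisfying \<open>P\<close>. Since such times occur arbitrarily late, the closed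
  hulls of the integer-indexed tails are nonempty, and they decrease. Allowing a general
  \<open>P\<close> makes it possible to select the times at which a convergence would fail.\<close>

lemma tail_hulls_inter_nonempty:
  fixes x :: "real \<Rightarrow> 'a::{real_inner, complete_space}"
  assumes bounded: "bounded (x ` {T0..})"
    and freq: "\<exists>\<^sub>F t in at_top. P t"
  obtains p where "\<And>T. p \<in> closure (convex hull (x ` {t. T \<le> t \<and> P t}))"
proof -
  define C where "C n = closure (convex hull (x ` {t. T0 + real n \<le> t \<and> P t}))" for n
  have "(\<Inter>n. C n) \<noteq> {}"
  proof (rule nested_convex_inter_nonempty)
    show "decseq C"
      unfolding C_def decseq_def
      by (intro allI impI closure_mono hull_mono image_mono) auto
    show "C n \<noteq> {}" for n
    proof -
      obtain t where "t \<ge> T0 + real n" "P t"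
        using freq unfolding frequently_def eventually_at_top_linorder by blast
      then show ?thesis unfolding C_def by auto
    qed
    have "bounded (x ` {t. T0 + real 0 \<le> t \<and> P t})"
      by (rule bounded_subset[OF bounded]) auto
    then show "bounded (C 0)"
      unfolding C_def by (intro bounded_closure bounded_convex_hull)
  qed (auto simp: C_def convex_closure convex_convex_hull)
  then obtain p where p: "\<And>n. p \<in> C n" by auto
  have "p \<in> closure (convex hull (x ` {t. T \<le> t \<and> P t}))" for T
  proof -
    obtain n where "T - T0 \<le> real n" using real_arch_simple by blast
    then have "C n \<subseteq> closure (convex hull (x ` {t. T \<le> t \<and> P t}))"
      unfolding C_def by (intro closure_mono hull_mono image_mono) auto
    then show ?thesis using p by blast
  qed
  then show thesis by (rule that)
qed

section \<open>Bounded linear functionals on closed convex hulls\<close>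

lemma closure_convex_hull_subset:
  "closed K \<Longrightarrow> convex K \<Longrightarrow> A \<subseteq> K \<Longrightarrow> closure (convex hull A) \<subseteq> K"
  by (simp add: closure_minimal hull_minimal)

text \<open>The half-space \<open>{y. \<phi> y \<le> b}\<close> is closed and convex, hence contains
  the closed convex hull of any set that it contains.\<close>

lemma linear_le_on_hull:
  fixes \<phi> :: "'a::real_normed_vector \<Rightarrow> real"
  assumes "bounded_linear \<phi>" "p \<in> closure (convex hull A)" "\<And>y. y \<in> A \<Longrightarrow> \<phi> y \<le> b"
  shows "\<phi> p \<le> b"
proof -
  interpret bounded_linear \<phi> by fact
  have "continuous_on UNIV \<phi>" by (intro continuous_on continuous_on_id)
  then have "closed {y. \<phi> y \<le> b}"
    by (intro closed_Collect_le continuous_on_const)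
  moreover have "{y. \<phi> y \<le> b} = \<phi> -` {..b}" by auto
  then have "convex {y. \<phi> y \<le> b}"
    using convex_linear_vimage[OF linear_axioms, of "{..b}"] by simp
  ultimately show ?thesis
    using closure_convex_hull_subset[of "{y. \<phi> y \<le> b}" A] assms by auto
qed

text \<open>An eventual upper bound for a functional along \<open>x\<close> passes to
  \<open>p\<close> through the closed hull of a late tail. Using this for \<open>\<phi>\<close> and
  for \<open>- \<phi>\<close> gives both inequalities.\<close>

lemma linear_lim_on_tail_hulls:
  fixes \<phi> :: "'a::real_normed_vector \<Rightarrow> real" and x :: "real \<Rightarrow> 'a"
  assumes \<phi>: "bounded_linear \<phi>" and lim: "((\<lambda>t. \<phi> (x t)) \<longlongrightarrow> l) at_top"
    and p: "\<And>T. p \<in> closure (convex hull (x ` {T..}))"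
  shows "\<phi> p = l"
proof -
  have le: "\<psi> p \<le> k" if \<psi>: "bounded_linear \<psi>" "((\<lambda>t. \<psi> (x t)) \<longlongrightarrow> k) at_top"
    for \<psi> :: "'a \<Rightarrow> real" and k
  proof (rule field_le_epsilon)
    fix e :: real assume "e > 0"
    then have "\<forall>\<^sub>F t in at_top. \<psi> (x t) < k + e"
      using \<psi>(2) by (intro order_tendstoD) auto
    then obtain T where "\<And>t. t \<ge> T \<Longrightarrow> \<psi> (x t) < k + e"
      by (auto simp: eventually_at_top_linorder)
    then show "\<psi> p \<le> k + e"
      by (intro linear_le_on_hull[OF \<psi>(1) p[of T]]) force
  qed
  have "- \<phi> p \<le> - l"
    using le[of "\<lambda>y. - \<phi> y" "- l"] bounded_linear_minus[OF \<phi>] tendsto_minus[OF lim] by simp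
  with le[OF \<phi> lim] show ?thesis by simp
qed

section \<open>Weak convergence from converging distances\<close>

text \<open>Opial's lemma. Points common to all closed convex hulls of tails replace weak cluster
  points, so that neither the Riesz representation nor weak compactness is needed.\<close>

lemma opial:
  fixes x :: "real \<Rightarrow> 'a::{real_inner, complete_space}"
  assumes ne: "S \<noteq> {}"
    and conv: "\<And>z. z \<in> S \<Longrightarrow> \<exists>l. ((\<lambda>t. (norm (x t - z))\<^sup>2) \<longlongrightarrow> l) at_top"
    and cluster: "\<And>p. (\<And>T. p \<in> closure (convex hull (x ` {T..}))) \<Longrightarrow> p \<in> S"
  shows "\<exists>z\<in>S. weakly_tendsto x z at_top"
proof -
  obtain z l where "z \<in> S" and "((\<lambda>t. (norm (x t - z))\<^sup>2) \<longlongrightarrow> l) at_top"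
    using ne conv by blast
  then have "\<forall>\<^sub>F t in at_top. (norm (x t - z))\<^sup>2 < l + 1"
    by (intro order_tendstoD) auto
  then obtain T0 where T0: "\<And>t. t \<ge> T0 \<Longrightarrow> (norm (x t - z))\<^sup>2 < l + 1"
    by (auto simp: eventually_at_top_linorder)
  have "norm (x t) \<le> sqrt (l + 1) + norm z" if "t \<ge> T0" for t
    using T0[OF that] real_le_rsqrt[of "norm (x t - z)" "l + 1"]
      norm_triangle_sub[of "x t" z] by linarith
  then have bounded: "bounded (x ` {T0..})"
    by (auto simp: bounded_iff)
  obtain p where p: "\<And>T. p \<in> closure (convex hull (x ` {T..}))"
    using tail_hulls_inter_nonempty[OF bounded, of "\<lambda>_. True"] by (auto simp: atLeast_def)
  \<comment> \<open>The difference of the squared distances to \<open>p\<close> and \<open>q\<close>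
    is affine in the point, with linear part a multiple of the inner product with
    \<open>q - p\<close>. That inner product therefore converges along \<open>x\<close>, so it takes
    the same value at \<open>p\<close> and at \<open>q\<close>.\<close>
  have unique: "q = p" if q: "\<And>T. q \<in> closure (convex hull (x ` {T..}))" for q
  proof -
    have "p \<in> S" "q \<in> S" using p q cluster by auto
    then obtain k m where k: "((\<lambda>t. (norm (x t - p))\<^sup>2) \<longlongrightarrow> k) at_top"
      and m: "((\<lambda>t. (norm (x t - q))\<^sup>2) \<longlongrightarrow> m) at_top"
      using conv by blast
    have eq: "((norm (y - p))\<^sup>2 - (norm (y - q))\<^sup>2 - (norm p)\<^sup>2 + (norm q)\<^sup>2) / 2
      = y \<bullet> (q - p)" for y
      unfolding power2_norm_eq_inner by (simp add: inner_diff inner_commute field_simps)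
    have "((\<lambda>t. ((norm (x t - p))\<^sup>2 - (norm (x t - q))\<^sup>2 - (norm p)\<^sup>2 + (norm q)\<^sup>2) / 2)
       \<longlongrightarrow> (k - m - (norm p)\<^sup>2 + (norm q)\<^sup>2) / 2) at_top"
      by (intro tendsto_intros k m) simp
    note lim = this[unfolded eq]
    have "p \<bullet> (q - p) = q \<bullet> (q - p)"
      using linear_lim_on_tail_hulls[OF bounded_linear_inner_left lim p]
        linear_lim_on_tail_hulls[OF bounded_linear_inner_left lim q] by simp
    then have "(q - p) \<bullet> (q - p) = 0" by (simp add: inner_diff_left)
    then show ?thesis by simp
  qed
  \<comment> \<open>If the bound failed at arbitrarily late times, the hulls over just those times
    would share a point \<open>q\<close>. Uniqueness identifies it with \<open>p\<close>, although
    \<open>\<phi> q\<close> is at least \<open>\<phi> p + e\<close>.\<close>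
  have upper: "\<forall>\<^sub>F t in at_top. \<phi> (x t) < \<phi> p + e"
    if \<phi>: "bounded_linear \<phi>" and "e > 0" for \<phi> :: "'a \<Rightarrow> real" and e
  proof (rule ccontr)
    assume "\<not> ?thesis"
    then have "\<exists>\<^sub>F t in at_top. \<phi> p + e \<le> \<phi> (x t)"
      by (simp add: not_eventually not_less)
    then obtain q where
      q: "\<And>T. q \<in> closure (convex hull (x ` {t. T \<le> t \<and> \<phi> p + e \<le> \<phi> (x t)}))"
      using tail_hulls_inter_nonempty[OF bounded] by blast
    have "q \<in> closure (convex hull (x ` {T..}))" for T
      using q[of T] by (rule rev_subsetD) (intro closure_mono hull_mono image_mono, auto)
    then have "q = p" by (rule unique)
    moreover have "- \<phi> q \<le> - (\<phi> p + e)"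
      using bounded_linear_minus[OF \<phi>] q[of 0] by (rule linear_le_on_hull) auto
    ultimately show False using \<open>e > 0\<close> by simp
  qed
  have "((\<lambda>t. \<phi> (x t)) \<longlongrightarrow> \<phi> p) at_top" if \<phi>: "bounded_linear \<phi>" for \<phi> :: "'a \<Rightarrow> real"
  proof (rule order_tendstoI)
    fix a assume "a < \<phi> p"
    then show "\<forall>\<^sub>F t in at_top. a < \<phi> (x t)"
      using upper[OF bounded_linear_minus[OF \<phi>], of "\<phi> p - a"] by (simp add: algebra_simps)
  next
    fix a assume "\<phi> p < a"
    then show "\<forall>\<^sub>F t in at_top. \<phi> (x t) < a"
      using upper[OF \<phi>, of "a - \<phi> p"] by simp
  qed
  moreover have "p \<in> S" using p by (rule cluster)
  ultimately show ?thesis unfolding weakly_tendsto_def by blast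
qed

section \<open>Convexity and asymptotics of real functions\<close>

text \<open>On the line through \<open>u\<close> and \<open>v\<close> the function is convex in one
  real variable with slope \<open>g \<bullet> (v - u)\<close> at 0; the value at 1 lies above the
  tangent at 0.\<close>

lemma convex_on_gradient_inequality:
  fixes f :: "'a::real_inner \<Rightarrow> real"
  assumes convex: "convex_on UNIV f" and grad: "GDERIV f u :> g"
  shows "f v \<ge> f u + g \<bullet> (v - u)"
proof -
  define k where "k s = f (u + s *\<^sub>R (v - u))" for s
  have "convex_on UNIV k"
  proof (rule convex_onI)
    fix t a b :: real assume t: "0 < t" "t < 1"
    have "u + ((1 - t) * a + t * b) *\<^sub>R (v - u)
      = (1 - t) *\<^sub>R (u + a *\<^sub>R (v - u)) + t *\<^sub>R (u + b *\<^sub>R (v - u))"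
      by (simp add: algebra_simps)
    then show "k ((1 - t) *\<^sub>R a + t *\<^sub>R b) \<le> (1 - t) * k a + t * k b"
      unfolding k_def using convex_onD[OF convex, of t] t by simp
  qed simp
  moreover have "(k has_real_derivative g \<bullet> (v - u)) (at 0)"
  proof -
    have "((\<lambda>s. u + s *\<^sub>R (v - u)) has_derivative (\<lambda>s. s *\<^sub>R (v - u))) (at 0)"
      by (auto intro!: derivative_eq_intros)
    moreover have "(f has_derivative (\<lambda>h. h \<bullet> g)) (at (u + 0 *\<^sub>R (v - u)))"
      using grad by (simp add: gderiv_def)
    ultimately have "(k has_derivative (\<lambda>s. (s *\<^sub>R (v - u)) \<bullet> g)) (at 0)"
      unfolding k_def by (rule has_derivative_compose)
    then show ?thesis
      by (rule has_derivative_imp_has_field_derivative) (simp add: inner_commute)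
  qed
  ultimately have "k 1 - k 0 \<ge> (g \<bullet> (v - u)) * (1 - 0)"
    by (intro convex_on_imp_above_tangent[of UNIV]) auto
  then show ?thesis by (simp add: k_def)
qed

lemma nonincreasing_tendsto:
  fixes f :: "real \<Rightarrow> real"
  assumes deriv: "\<And>t. t \<ge> a \<Longrightarrow> (f has_real_derivative f' t) (at t)"
    and nonpos: "\<And>t. t \<ge> a \<Longrightarrow> f' t \<le> 0"
    and bound: "\<And>t. t \<ge> a \<Longrightarrow> b \<le> f t"
  shows "\<exists>l. (f \<longlongrightarrow> l) at_top"
proof -
  have anti: "f t \<le> f s" if "a \<le> s" "s \<le> t" for s t
    using \<open>s \<le> t\<close>
  proof (rule DERIV_nonpos_imp_nonincreasing)
    fix r assume "s \<le> r"
    then show "\<exists>y. (f has_real_derivative y) (at r) \<and> y \<le> 0"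
      using that deriv[of r] nonpos[of r] by auto
  qed
  define l where "l = (INF t\<in>{a..}. f t)"
  have bdd: "bdd_below (f ` {a..})" using bound by (intro bdd_belowI2[where m=b]) auto
  have "(f \<longlongrightarrow> l) at_top"
  proof (rule decreasing_tendsto)
    show "\<forall>\<^sub>F t in at_top. l \<le> f t"
      using eventually_ge_at_top[of a]
      by eventually_elim (auto simp: l_def intro: cINF_lower[OF bdd])
  next
    fix y assume "l < y"
    then obtain s where s: "s \<ge> a" "f s < y"
      unfolding l_def using cINF_less_iff[OF _ bdd] by auto
    show "\<forall>\<^sub>F t in at_top. f t < y"
      using eventually_ge_at_top[of s] by eventually_elim (use anti s in force)
  qed
  then show ?thesis ..
qed

text \<open>The integrating factor is \<open>t powr c\<close>: the derivative of
  \<open>t powr c * h t\<close>, divided by that of \<open>t powr c\<close>, is exactly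
  \<open>(t * h' t + c * h t) / c\<close>, whose limit is known.\<close>

lemma tendsto_of_linear_ode:
  fixes h :: "real \<Rightarrow> real"
  assumes deriv: "\<And>t. t \<ge> a \<Longrightarrow> (h has_real_derivative h' t) (at t)"
    and "c > 0"
    and lim: "((\<lambda>t. t * h' t + c * h t) \<longlongrightarrow> l) at_top"
  shows "(h \<longlongrightarrow> l / c) at_top"
proof -
  \<comment> \<open>The bound 1 keeps \<open>t\<close> positive, as the rules for
    \<open>powr\<close> require; the bound \<open>a\<close> makes \<open>h\<close>
    differentiable.\<close>
  have ev: "\<forall>\<^sub>F t in at_top. t \<ge> max a 1"
    by (rule eventually_ge_at_top)
  have "((\<lambda>t. (t powr c * h t) / (t powr c)) \<longlongrightarrow> l / c) at_top"
  proof (rule lhospital_at_top_at_top)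
    have "LIM t at_top. exp (c * ln t) :> at_top"
      using \<open>c > 0\<close>
      by (intro filterlim_compose[OF exp_at_top]
          filterlim_tendsto_pos_mult_at_top[OF tendsto_const _ ln_at_top])
    then show "LIM t at_top. t powr c :> at_top"
    proof (rule filterlim_cong[THEN iffD1, OF refl refl, rotated])
      show "\<forall>\<^sub>F t in at_top. exp (c * ln t) = t powr c"
        using ev by eventually_elim (simp add: powr_def)
    qed
    show "\<forall>\<^sub>F t in at_top. c * t powr (c - 1) \<noteq> 0"
      using ev by eventually_elim (use \<open>c > 0\<close> in auto)
    show "\<forall>\<^sub>F t in at_top. ((\<lambda>t. t powr c) has_real_derivative c * t powr (c - 1)) (at t)"
      using ev by eventually_elim (auto intro!: derivative_eq_intros)
    show "\<forall>\<^sub>F t in at_top. ((\<lambda>t. t powr c * h t) has_real_derivative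
        (c * t powr (c - 1) * h t + t powr c * h' t)) (at t)"
      using ev by eventually_elim (auto intro!: derivative_eq_intros deriv)
    have "((\<lambda>t. (t * h' t + c * h t) / c) \<longlongrightarrow> l / c) at_top"
      using lim \<open>c > 0\<close> by (intro tendsto_divide) auto
    then show "((\<lambda>t. (c * t powr (c - 1) * h t + t powr c * h' t) / (c * t powr (c - 1)))
        \<longlongrightarrow> l / c) at_top"
    proof (rule Lim_transform_eventually)
      show "\<forall>\<^sub>F t in at_top. (t * h' t + c * h t) / c
        = (c * t powr (c - 1) * h t + t powr c * h' t) / (c * t powr (c - 1))"
        using ev
      proof eventually_elim
        case (elim t)
        then have "t powr c = t * t powr (c - 1)" by (simp add: powr_diff)
        then show ?case using elim \<open>c > 0\<close> by (simp add: field_simps)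
      qed
    qed
  qed
  then show ?thesis
    by (rule Lim_transform_eventually) (use ev in \<open>eventually_elim, auto\<close>)
qed


section \<open>Energies along a trajectory and their derivatives\<close>

lemma has_real_derivative_inner:
  assumes "(f has_vector_derivative f') (at t)" "(g has_vector_derivative g') (at t)"
  shows "((\<lambda>t. f t \<bullet> g t) has_real_derivative (f t \<bullet> g' + f' \<bullet> g t)) (at t)"
  using bounded_bilinear.has_vector_derivative[OF bounded_bilinear_inner assms]
  by (simp add: has_real_derivative_iff_has_vector_derivative)

text \<open>The minimizer \<open>z\<close> is fixed here but arbitrary, as convergence of the
  distance is wanted for each one. Derivatives are two-sided, so \<open>a\<close> has to be taken in
  the interior of the half-line on which the solution is given.\<close>

locale inertial_trajectory =
  fixes \<Phi> :: "'h::real_inner \<Rightarrow> real" and G :: "'h \<Rightarrow> 'h"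
    and x x' x'' :: "real \<Rightarrow> 'h" and \<alpha> a :: real and z :: 'h
  assumes grad: "\<And>u. GDERIV \<Phi> u :> G u"
    and convex: "convex_on UNIV \<Phi>"
    and minimizer: "\<And>u. \<Phi> z \<le> \<Phi> u"
    and a_pos: "a > 0"
    and alpha: "\<alpha> > 3"
    and vel: "\<And>t. t \<ge> a \<Longrightarrow> (x has_vector_derivative x' t) (at t)"
    and acc: "\<And>t. t \<ge> a \<Longrightarrow> (x' has_vector_derivative x'' t) (at t)"
    and ode: "\<And>t. t \<ge> a \<Longrightarrow> x'' t + (\<alpha> / t) *\<^sub>R x' t + G (x t) = 0"
begin

definition gap :: "real \<Rightarrow> real" where
  "gap t = \<Phi> (x t) - \<Phi> z"

text \<open>The weight \<open>\<alpha> - 1\<close> is chosen to absorb the damping: with the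
  velocity coming from the product rule it produces \<open>\<alpha> *\<^sub>R x' t\<close>, and the
  equation leaves only the gradient term in the derivative.\<close>

definition anchor :: "real \<Rightarrow> 'h" where
  "anchor t = (\<alpha> - 1) *\<^sub>R (x t - z) + t *\<^sub>R x' t"

definition anchored_energy :: "real \<Rightarrow> real" where
  "anchored_energy t = t\<^sup>2 * gap t + (anchor t \<bullet> anchor t) / 2"

definition mechanical_energy :: "real \<Rightarrow> real" where
  "mechanical_energy t = t\<^sup>2 * (gap t + (x' t \<bullet> x' t) / 2)"

text \<open>The weights make the terms in \<open>gap\<close> cancel in the derivative, so that this function
  stands in for the integral of \<open>s \<parallel>x' s\<parallel>\<^sup>2\<close> over \<open>{t..}\<close>.\<close>

definition dissipation :: "real \<Rightarrow> real" where
  "dissipation t = (mechanical_energy t + 2 / (\<alpha> - 3) * anchored_energy t) / (\<alpha> - 1)"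

lemma t_pos: "t \<ge> a \<Longrightarrow> t > 0"
  using a_pos by simp

lemma gap_nonneg: "0 \<le> gap t"
  using minimizer by (simp add: gap_def)

lemma gap_le: "gap t \<le> (x t - z) \<bullet> G (x t)"
  using convex_on_gradient_inequality[OF convex grad, of "x t" z]
  by (simp add: gap_def inner_diff inner_commute)

lemma scaled_ode: "t \<ge> a \<Longrightarrow> t *\<^sub>R x'' t = - \<alpha> *\<^sub>R x' t - t *\<^sub>R G (x t)"
proof -
  assume t: "t \<ge> a"
  have "t *\<^sub>R (x'' t + (\<alpha> / t) *\<^sub>R x' t + G (x t)) = 0"
    by (simp add: ode[OF t])
  then show ?thesis
    using t_pos[OF t] by (simp add: scaleR_add_right eq_diff_eq eq_neg_iff_add_eq_0 ac_simps)
qed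

lemma gap_deriv: "t \<ge> a \<Longrightarrow> (gap has_real_derivative x' t \<bullet> G (x t)) (at t)"
proof -
  assume t: "t \<ge> a"
  have "((\<lambda>s. \<Phi> (x s)) has_derivative (\<lambda>s. (s *\<^sub>R x' t) \<bullet> G (x t))) (at t)"
    using has_derivative_compose vel[OF t] grad[of "x t"]
    unfolding has_vector_derivative_def gderiv_def by blast
  then have "((\<lambda>s. \<Phi> (x s)) has_real_derivative x' t \<bullet> G (x t)) (at t)"
    by (rule has_derivative_imp_has_field_derivative) simp
  then show ?thesis
    unfolding gap_def by (auto intro!: derivative_eq_intros)
qed

lemma anchor_deriv: "t \<ge> a \<Longrightarrow> (anchor has_vector_derivative - (t *\<^sub>R G (x t))) (at t)"
proof -
  assume t: "t \<ge> a"
  have "(anchor has_vector_derivative (\<alpha> - 1) *\<^sub>R x' t + (t *\<^sub>R x'' t + x' t)) (at t)"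
    unfolding anchor_def by (auto intro!: derivative_eq_intros vel[OF t] acc[OF t])
  then show ?thesis
    by (simp add: scaled_ode[OF t] algebra_simps)
qed

text \<open>The products of velocity and gradient coming from \<open>gap\<close> and from
  \<open>anchor\<close> cancel. By \<open>gap_le\<close> the remaining expression is at most
  \<open>(3 - \<alpha>) * t * gap t\<close>.\<close>

lemma anchored_energy_deriv:
  assumes t: "t \<ge> a"
  shows "(anchored_energy has_real_derivative
    2 * t * gap t - (\<alpha> - 1) * t * ((x t - z) \<bullet> G (x t))) (at t)"
proof -
  have "(anchored_energy has_real_derivative 2 * t * gap t + t\<^sup>2 * (x' t \<bullet> G (x t))
      - t * (anchor t \<bullet> G (x t))) (at t)"
    unfolding anchored_energy_def
    by (auto intro!: derivative_eq_intros gap_deriv[OF t]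
        has_real_derivative_inner[OF anchor_deriv[OF t] anchor_deriv[OF t]]
        simp: inner_commute algebra_simps)
  then show ?thesis
    unfolding anchor_def by (simp add: inner_add_left power2_eq_square algebra_simps)
qed

text \<open>The work of the gradient cancels. Damping contributes
  \<open>- \<alpha> * t * (x' t \<bullet> x' t)\<close>, and differentiating the factor
  \<open>t\<^sup>2\<close> gives back one \<open>t * (x' t \<bullet> x' t)\<close>.\<close>

lemma mechanical_energy_deriv:
  assumes t: "t \<ge> a"
  shows "(mechanical_energy has_real_derivative
    2 * t * gap t - (\<alpha> - 1) * t * (x' t \<bullet> x' t)) (at t)"
proof -
  have "(mechanical_energy has_real_derivative 2 * t * (gap t + (x' t \<bullet> x' t) / 2)
      + t * (x' t \<bullet> (t *\<^sub>R x'' t) + t * (x' t \<bullet> G (x t)))) (at t)"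
    unfolding mechanical_energy_def
    by (auto intro!: derivative_eq_intros gap_deriv[OF t]
        has_real_derivative_inner[OF acc[OF t] acc[OF t]]
        simp: inner_commute power2_eq_square algebra_simps)
  then show ?thesis
    unfolding scaled_ode[OF t] by (simp add: inner_diff_right algebra_simps)
qed

text \<open>The anchored energy loses at least \<open>(\<alpha> - 3) * t * gap t\<close>, so the
  weight \<open>2 / (\<alpha> - 3)\<close> offsets the gain \<open>2 * t * gap t\<close> of the
  mechanical energy. Division by \<open>\<alpha> - 1\<close> normalizes what is left.\<close>

lemma dissipation_deriv:
  assumes t: "t \<ge> a"
  obtains d where "(dissipation has_real_derivative d) (at t)" "d \<le> - t * (x' t \<bullet> x' t)"
proof
  let ?d = "(2 * t * gap t - (\<alpha> - 1) * t * (x' t \<bullet> x' t) + 2 / (\<alpha> - 3)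
     * (2 * t * gap t - (\<alpha> - 1) * t * ((x t - z) \<bullet> G (x t)))) / (\<alpha> - 1)"
  show "(dissipation has_real_derivative ?d) (at t)"
    unfolding dissipation_def using alpha
    by (auto intro!: derivative_eq_intros mechanical_energy_deriv[OF t] anchored_energy_deriv[OF t])
  have "(\<alpha> - 1) * t * gap t \<le> (\<alpha> - 1) * t * ((x t - z) \<bullet> G (x t))"
    using alpha t_pos[OF t] by (intro mult_left_mono gap_le) auto
  then have "2 / (\<alpha> - 3) * (2 * t * gap t - (\<alpha> - 1) * t * ((x t - z) \<bullet> G (x t)))
      \<le> 2 / (\<alpha> - 3) * (2 * t * gap t - (\<alpha> - 1) * t * gap t)"
    using alpha by (intro mult_left_mono) auto
  also have "2 * t * gap t - (\<alpha> - 1) * t * gap t = (\<alpha> - 3) * (- t * gap t)"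
    by (simp add: algebra_simps)
  also have "2 / (\<alpha> - 3) * \<dots> = - 2 * t * gap t"
    using alpha by simp
  finally have "2 / (\<alpha> - 3) * (2 * t * gap t - (\<alpha> - 1) * t * ((x t - z) \<bullet> G (x t)))
      \<le> - 2 * t * gap t" .
  then have "2 * t * gap t - (\<alpha> - 1) * t * (x' t \<bullet> x' t) + 2 / (\<alpha> - 3)
     * (2 * t * gap t - (\<alpha> - 1) * t * ((x t - z) \<bullet> G (x t))) \<le> - (\<alpha> - 1) * t * (x' t \<bullet> x' t)"
    by linarith
  then have "?d \<le> (- (\<alpha> - 1) * t * (x' t \<bullet> x' t)) / (\<alpha> - 1)"
    using alpha by (intro divide_right_mono) simp_all
  also have "\<dots> = - t * (x' t \<bullet> x' t)"
    using alpha by (simp add: field_simps)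
  finally show "?d \<le> - t * (x' t \<bullet> x' t)" .
qed

lemma anchored_energy_nonneg: "0 \<le> anchored_energy t"
  by (simp add: anchored_energy_def gap_nonneg)

lemma mechanical_energy_nonneg: "0 \<le> mechanical_energy t"
  by (simp add: mechanical_energy_def gap_nonneg)

lemma dissipation_nonneg: "0 \<le> dissipation t"
  using alpha by (simp add: dissipation_def mechanical_energy_nonneg anchored_energy_nonneg)

section \<open>Bounds and limits as time tends to infinity\<close>

lemma dissipation_tendsto: "\<exists>l. (dissipation \<longlongrightarrow> l) at_top"
proof -
  have "\<exists>d. (dissipation has_real_derivative d) (at t) \<and> d \<le> 0" if t: "t \<ge> a" for t
  proof -
    obtain d where "(dissipation has_real_derivative d) (at t)" "d \<le> - t * (x' t \<bullet> x' t)"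
      using t by (rule dissipation_deriv)
    moreover have "0 \<le> t * (x' t \<bullet> x' t)"
      using t_pos[OF t] by simp
    ultimately show ?thesis by fastforce
  qed
  then obtain d where "\<And>t. t \<ge> a \<Longrightarrow> (dissipation has_real_derivative d t) (at t)"
    and "\<And>t. t \<ge> a \<Longrightarrow> d t \<le> 0"
    by metis
  then show ?thesis
    using dissipation_nonneg by (rule nonincreasing_tendsto)
qed

text \<open>Both summands of the convergent function \<open>dissipation\<close> are nonnegative, so
  a bound on the sum bounds each of them.\<close>

lemma energies_eventually_bounded:
  obtains M T where "T \<ge> a" "\<And>t. t \<ge> T \<Longrightarrow> mechanical_energy t \<le> M"
    "\<And>t. t \<ge> T \<Longrightarrow> anchored_energy t \<le> M"
proof -
  obtain l where "(dissipation \<longlongrightarrow> l) at_top" using dissipation_tendsto ..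
  then have "\<forall>\<^sub>F t in at_top. dissipation t < l + 1"
    by (intro order_tendstoD) auto
  then obtain T where T: "\<And>t. t \<ge> T \<Longrightarrow> dissipation t < l + 1"
    by (auto simp: eventually_at_top_linorder)
  define N where "N = (l + 1) * (\<alpha> - 1)"
  have sum: "mechanical_energy t + 2 / (\<alpha> - 3) * anchored_energy t \<le> N" if "t \<ge> T" for t
    using T[OF that] alpha by (simp add: dissipation_def N_def pos_divide_less_eq)
  have nonneg: "0 \<le> 2 / (\<alpha> - 3) * anchored_energy t" for t
    using alpha anchored_energy_nonneg by simp
  have mech: "mechanical_energy t \<le> N" if "t \<ge> T" for t
    using sum[OF that] nonneg[of t] by linarith
  have anch: "anchored_energy t \<le> N * (\<alpha> - 3) / 2" if "t \<ge> T" for t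
  proof -
    have "2 / (\<alpha> - 3) * anchored_energy t \<le> N"
      using sum[OF that] mechanical_energy_nonneg[of t] by linarith
    then show ?thesis using alpha by (simp add: field_simps)
  qed
  show thesis
    by (rule that[of "max a T" "max N (N * (\<alpha> - 3) / 2)"]) (use mech anch in \<open>force+\<close>)
qed

text \<open>The anchored energy dominates \<open>t\<^sup>2 * gap t\<close>, so its boundedness makes
  the gap decay at least like \<open>M / t\<^sup>2\<close>.\<close>

lemma objective_tendsto: "((\<lambda>t. \<Phi> (x t)) \<longlongrightarrow> \<Phi> z) at_top"
proof -
  obtain M T where T: "T \<ge> a" "\<And>t. t \<ge> T \<Longrightarrow> anchored_energy t \<le> M"
    by (metis energies_eventually_bounded)
  have "gap t \<le> M / t\<^sup>2" if "t \<ge> T" for t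
  proof -
    have "t\<^sup>2 * gap t \<le> M"
      using T(2)[OF that] inner_ge_zero[of "anchor t"] unfolding anchored_energy_def by linarith
    then show ?thesis using t_pos[of t] that T(1) by (simp add: field_simps)
  qed
  then have upper: "\<forall>\<^sub>F t in at_top. gap t \<le> M / t\<^sup>2"
    using eventually_ge_at_top[of T] by (rule eventually_mono[rotated])
  have "((\<lambda>t::real. M / t\<^sup>2) \<longlongrightarrow> 0) at_top"
    by (intro real_tendsto_divide_at_top[of _ M] tendsto_const filterlim_pow_at_top filterlim_ident) simp
  then have "(gap \<longlongrightarrow> 0) at_top"
    using gap_nonneg upper by (intro tendsto_sandwich[of "\<lambda>_. 0" gap at_top]) auto
  then have "((\<lambda>t. gap t + \<Phi> z) \<longlongrightarrow> 0 + \<Phi> z) at_top"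
    by (intro tendsto_intros)
  then show ?thesis by (simp add: gap_def)
qed

lemma distance_tendsto: "\<exists>l. ((\<lambda>t. (norm (x t - z))\<^sup>2) \<longlongrightarrow> l) at_top"
proof -
  obtain M T where T: "T \<ge> a"
    and mech: "\<And>t. t \<ge> T \<Longrightarrow> mechanical_energy t \<le> M"
    and anch: "\<And>t. t \<ge> T \<Longrightarrow> anchored_energy t \<le> M"
    by (metis energies_eventually_bounded)
  \<comment> \<open>Each energy contains half a squared norm, so \<open>R\<close> bounds the norms
    of \<open>anchor t\<close> and of \<open>t *\<^sub>R x' t\<close>.\<close>
  define R where "R = sqrt (2 * M)"
  define h where "h t = (x t - z) \<bullet> (x t - z) / 2" for t
  define h' where "h' t = (x t - z) \<bullet> x' t" for t
  have h_deriv: "(h has_real_derivative h' t) (at t)" if "t \<ge> a" for t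
    unfolding h_def h'_def using that
    by (auto intro!: derivative_eq_intros has_real_derivative_inner vel simp: inner_commute)
  have h'_deriv: "(h' has_real_derivative ((x t - z) \<bullet> x'' t + x' t \<bullet> x' t)) (at t)"
    if "t \<ge> a" for t
    unfolding h'_def using that
    by (auto intro!: derivative_eq_intros has_real_derivative_inner vel acc)
  \<comment> \<open>The difference of \<open>anchor t\<close> and \<open>t *\<^sub>R x' t\<close> is
    \<open>(\<alpha> - 1) *\<^sub>R (x t - z)\<close>, which bounds the distance to \<open>z\<close>
    by \<open>2 * R\<close>; the Cauchy-Schwarz inequality then bounds
    \<open>t * h' t\<close>.\<close>
  have lower: "- (2 * R * R) \<le> t * h' t" if t: "t \<ge> T" for t
  proof -
    have "0 < t" using T t a_pos by simp
    have "0 \<le> t\<^sup>2 * gap t" using gap_nonneg by simp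
    then have "anchor t \<bullet> anchor t \<le> 2 * M" "(t *\<^sub>R x' t) \<bullet> (t *\<^sub>R x' t) \<le> 2 * M"
      using anch[OF t] mech[OF t]
      by (simp_all add: anchored_energy_def mechanical_energy_def power2_eq_square algebra_simps)
    then have 1: "norm (anchor t) \<le> R" and 2: "norm (t *\<^sub>R x' t) \<le> R"
      unfolding R_def norm_eq_sqrt_inner by simp_all
    have "(\<alpha> - 1) * norm (x t - z) = norm (anchor t - t *\<^sub>R x' t)"
      using alpha by (simp add: anchor_def)
    also have "\<dots> \<le> R + R"
      using 1 2 norm_triangle_ineq4[of "anchor t" "t *\<^sub>R x' t"] by linarith
    finally have "(\<alpha> - 1) * norm (x t - z) \<le> 2 * R" by simp
    moreover have "1 * norm (x t - z) \<le> (\<alpha> - 1) * norm (x t - z)"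
      using alpha by (intro mult_right_mono) auto
    ultimately have "norm (x t - z) \<le> 2 * R" by linarith
    then have "norm (x t - z) * norm (t *\<^sub>R x' t) \<le> 2 * R * R"
      using 2 order_trans[OF norm_ge_zero 2] by (intro mult_mono) auto
    then have "\<bar>(x t - z) \<bullet> (t *\<^sub>R x' t)\<bar> \<le> 2 * R * R"
      using Cauchy_Schwarz_ineq2 by (rule order_trans[rotated])
    then show ?thesis by (simp add: h'_def)
  qed
  \<comment> \<open>The coefficient \<open>\<alpha> - 1\<close> again absorbs the damping: the
    derivative collects \<open>\<alpha> * h' t\<close>, which the friction term of the equation
    cancels.\<close>
  define g where "g t = t * h' t + (\<alpha> - 1) * h t" for t
  have g_deriv: "(g has_real_derivative (t * (x' t \<bullet> x' t) - t * ((x t - z) \<bullet> G (x t)))) (at t)"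
    if t: "t \<ge> a" for t
  proof -
    have "(g has_real_derivative
        ((x t - z) \<bullet> (t *\<^sub>R x'' t) + t * (x' t \<bullet> x' t) + \<alpha> * h' t)) (at t)"
      unfolding g_def
      by (auto intro!: derivative_eq_intros h_deriv[OF t] h'_deriv[OF t] simp: algebra_simps)
    then show ?thesis
      unfolding scaled_ode[OF t] by (simp add: h'_def inner_diff_right algebra_simps)
  qed
  \<comment> \<open>The decay of \<open>dissipation\<close> outweighs the term
    \<open>t * (x' t \<bullet> x' t)\<close> in the derivative of \<open>g\<close>; the other term
    has the right sign because \<open>gap\<close> is nonnegative.\<close>
  have "\<exists>d. ((\<lambda>t. g t + dissipation t) has_real_derivative d) (at t) \<and> d \<le> 0"
    if t: "t \<ge> a" for t
  proof -
    obtain d where d: "(dissipation has_real_derivative d) (at t)" "d \<le> - t * (x' t \<bullet> x' t)"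
      using t by (rule dissipation_deriv)
    have "0 \<le> t * ((x t - z) \<bullet> G (x t))"
      using t_pos[OF t] gap_nonneg[of t] gap_le[of t] by simp
    then have "t * (x' t \<bullet> x' t) - t * ((x t - z) \<bullet> G (x t)) + d \<le> 0"
      using d(2) by simp
    then show ?thesis using DERIV_add[OF g_deriv[OF t] d(1)] by blast
  qed
  then obtain d where d: "\<And>t. t \<ge> a \<Longrightarrow> ((\<lambda>t. g t + dissipation t) has_real_derivative d t) (at t)"
    "\<And>t. t \<ge> a \<Longrightarrow> d t \<le> 0"
    by metis
  have "- (2 * R * R) \<le> g t + dissipation t" if "t \<ge> T" for t
  proof -
    have "0 \<le> (\<alpha> - 1) * h t" using alpha by (simp add: h_def)
    then show ?thesis
      using lower[OF that] dissipation_nonneg[of t] unfolding g_def by linarith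
  qed
  then obtain k where "((\<lambda>t. g t + dissipation t) \<longlongrightarrow> k) at_top"
    using nonincreasing_tendsto[of T "\<lambda>t. g t + dissipation t" d "- (2 * R * R)"] d T
      order_trans[OF T] by blast
  moreover obtain l where "(dissipation \<longlongrightarrow> l) at_top" using dissipation_tendsto ..
  ultimately have "((\<lambda>t. g t + dissipation t - dissipation t) \<longlongrightarrow> k - l) at_top"
    by (rule tendsto_diff)
  then have "(h \<longlongrightarrow> (k - l) / (\<alpha> - 1)) at_top"
    using alpha h_deriv by (intro tendsto_of_linear_ode[of a h h']) (auto simp: g_def)
  then have "((\<lambda>t. 2 * h t) \<longlongrightarrow> 2 * ((k - l) / (\<alpha> - 1))) at_top"
    by (intro tendsto_intros)
  then show ?thesis
    unfolding h_def by (auto simp: power2_norm_eq_inner)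
qed

end

section \<open>Weak convergence of the trajectory to a minimizer\<close>

theorem theorem2p15:
  fixes \<Phi> :: "'h::{real_inner, complete_space} \<Rightarrow> real"
    and grad\<Phi> :: "'h \<Rightarrow> 'h"
    and x :: "real \<Rightarrow> 'h"
    and t0 \<alpha> :: real
  assumes "C1_with_gradient \<Phi> grad\<Phi>"
    and "convex_on UNIV \<Phi>"
    and "argmin \<Phi> \<noteq> {}"
    and "t0 > 0"
    and "\<alpha> > 3"
    and "avd_solution \<alpha> grad\<Phi> t0 x"
  shows "\<exists>z \<in> argmin \<Phi>. weakly_tendsto x z at_top"
proof (rule opial)
  obtain x' x'' where
    vel: "\<And>t. t \<ge> t0 \<Longrightarrow> (x has_vector_derivative x' t) (at t within {t0..})" and
    acc: "\<And>t. t \<ge> t0 \<Longrightarrow> (x' has_vector_derivative x'' t) (at t within {t0..})" and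
    ode: "\<And>t. t \<ge> t0 \<Longrightarrow> x'' t + (\<alpha> / t) *\<^sub>R x' t + grad\<Phi> (x t) = 0"
    using assms(6) unfolding avd_solution_def by blast
  \<comment> \<open>Starting one unit after \<open>t0\<close> places every time in the interior of
    the half-line, where the derivatives within it are ordinary ones.\<close>
  have at: "at t within {t0..} = at t" if "t \<ge> t0 + 1" for t
    using that by (intro at_within_interior) simp
  have trajectory: "inertial_trajectory \<Phi> grad\<Phi> x x' x'' \<alpha> (t0 + 1) z" if "z \<in> argmin \<Phi>" for z
  proof
    show "\<And>u. GDERIV \<Phi> u :> grad\<Phi> u"
      using assms(1) by (simp add: C1_with_gradient_def)
    show "\<And>u. \<Phi> z \<le> \<Phi> u"
      using that by (simp add: argmin_def is_arg_min_linorder)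
    show "(x has_vector_derivative x' t) (at t)" if "t \<ge> t0 + 1" for t
      using vel[of t] that at[OF that] by simp
    show "(x' has_vector_derivative x'' t) (at t)" if "t \<ge> t0 + 1" for t
      using acc[of t] that at[OF that] by simp
  qed (use assms ode in auto)
  show "argmin \<Phi> \<noteq> {}" by fact
  show "\<exists>l. ((\<lambda>t. (norm (x t - z))\<^sup>2) \<longlongrightarrow> l) at_top" if "z \<in> argmin \<Phi>" for z
    using trajectory[OF that] by (rule inertial_trajectory.distance_tendsto)
  show "p \<in> argmin \<Phi>" if p: "\<And>T. p \<in> closure (convex hull (x ` {T..}))" for p
  proof -
    obtain z where z: "z \<in> argmin \<Phi>" using assms(3) by blast
    have "continuous_on UNIV \<Phi>"
      using assms(1) unfolding C1_with_gradient_def gderiv_def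
      by (meson continuous_at_imp_continuous_on has_derivative_continuous)
    have "\<Phi> p \<le> \<Phi> z"
    proof (rule field_le_epsilon)
      fix e :: real assume "e > 0"
      \<comment> \<open>This sublevel set is closed and convex and contains a tail of the
        trajectory, hence also the closed hull of that tail and with it \<open>p\<close>. The
        argument stands in for weak lower semicontinuity of \<open>\<Phi>\<close>.\<close>
      define K where "K = {u. \<Phi> u \<le> \<Phi> z + e}"
      have "\<forall>\<^sub>F t in at_top. \<Phi> (x t) < \<Phi> z + e"
        using inertial_trajectory.objective_tendsto[OF trajectory[OF z]] \<open>e > 0\<close>
        by (intro order_tendstoD) auto
      then obtain T where "\<And>t. t \<ge> T \<Longrightarrow> \<Phi> (x t) < \<Phi> z + e"
        by (auto simp: eventually_at_top_linorder)
      then have "x ` {T..} \<subseteq> K" unfolding K_def by force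
      moreover have "closed K"
        unfolding K_def by (intro closed_Collect_le continuous_on_const) fact
      moreover have "convex K"
      proof (rule convexI)
        fix u v :: 'h and r s :: real
        assume "u \<in> K" "v \<in> K" and rs: "0 \<le> r" "0 \<le> s" "r + s = 1"
        then have "r * \<Phi> u + s * \<Phi> v \<le> \<Phi> z + e"
          unfolding K_def by (intro convex_bound_le) auto
        moreover have "\<Phi> (r *\<^sub>R u + s *\<^sub>R v) \<le> r * \<Phi> u + s * \<Phi> v"
          using assms(2) rs by (simp add: convex_on_def)
        ultimately show "r *\<^sub>R u + s *\<^sub>R v \<in> K" by (simp add: K_def)
      qed
      ultimately have "p \<in> K"
        using closure_convex_hull_subset[of K] p by blast
      then show "\<Phi> p \<le> \<Phi> z + e" by (simp add: K_def)
    qed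
    then show ?thesis
      using z by (auto simp: argmin_def is_arg_min_linorder intro: order_trans)
  qed
qed

end
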